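(* Let $(\theta,\varphi)$ be a continuous time random dynamical system (RDS) over a probability space $(\Omega,\mathcal F,\mathbb P)$ on a nonempty finite state space $X$ (equipped with the discrete topology). For $\omega\in\Omega$ define $$A(\omega):=\bigcap_{t\ge 0}\varphi(t,X,\theta_{-t}\omega).$$ Then: (a) $A(\omega)$ is nonempty for each $\omega\in\Omega$, and the sets $A(\omega)$ define (i.e. $A:=\{(x,\omega)\in X\times\Omega : x\in A(\omega)\}$ is) both a global random pullback attractor and a global random forward attractor of $(\theta,\varphi)$. (b) For each $\omega\in\Omega$ there exists $T(\omega)>0$ such that $\varphi(t,X,\theta_{-t}\omega)=A(\omega)$ for all $t\ge T(\omega)$. (c) For almost every $\omega\in\Omega$ there exists $\widehat T(\omega)>0$ such that $\varphi(t,X,\omega)=A(\theta_t\omega)$ for all $t\ge\widehat T(\omega)$.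
   Context: RDS: A continuous time random dynamical system $(\theta,\varphi)$ on a topological space $X$ (with its Borel $\sigma$-algebra) consists of (I) a family $\theta=\{\theta_t\}_{t\in\mathbb R}$ of maps on a probability space $(\Omega,\mathcal F,\mathbb P)$ with $\theta_0(\omega)=\omega$, $\theta_{s+t}(\omega)=\theta_s\circ\theta_t(\omega)$ for all $\omega\in\Omega$ and $s,t\in\mathbb R$, $(t,\omega)\mapsto\theta_t(\omega)$ measurable, and $\mathbb P(\theta_tB)=\mathbb P(B)$ for all $B\in\mathcal F$, $t\in\mathbb R$; (II) a map $\varphi:\mathbb R_0^+\times X\times\Omega\to X$ (where $\mathbb R_0^+=[0,\infty)$) such that $\varphi(0,x,\omega)=x$ for all $x,\omega$; $\varphi(s+t,x,\omega)=\varphi(s,\varphi(t,x,\omega),\theta_t\omega)$ for all $s,t\ge 0$, $x\in X$, $\omega\in\Omega$; $(t,x,\omega)\mapsto\varphi(t,x,\omega)$ is measurable; and $x\mapsto\varphi(t,x,\omega)$ is continuous for all $(t,\omega)$. For $B\subseteq X$ write $\varphi(t,B,\omega)=\{\varphi(t,x,\omega): x\in B\}$. Finite state space convention: a finite $X$ carries the discrete topology and the metric $d(x,y)=1$ if $x\neq y$, $d(x,x)=0$. For subsets, $\mathrm{dist}(C,B):=\sup_{c\in C}\inf_{b\in B}d(c,b)$. Random set: a measurable subset $C$ of $X\times\Omega$ (product $\sigma$-algebra of the Borel $\sigma$-algebra of $X$ and $\mathcal F$), with sections $C(\omega)=\{x\in X:(x,\omega)\in C\}$; it is compact if every $C(\omega)$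 is compact. Attractors: A compact random set $A\subset X\times\Omega$ that is strictly $\varphi$-invariant, i.e. $\varphi(t,A(\omega),\omega)=A(\theta_t\omega)$ for every $t\ge 0$ almost surely, is called a global random pullback attractor if $\lim_{t\to\infty}\mathrm{dist}(\varphi(t,X,\theta_{-t}\omega),A(\omega))=0$ almost surely, and a global random forward attractor if $\lim_{t\to\infty}\mathrm{dist}(\varphi(t,X,\omega),A(\theta_t\omega))=0$ almost surely. *)

theory Defs
  imports "HOL-Probability.Probability"
begin

definition borel_of_topology :: "'x topology \<Rightarrow> 'x measure" where
  "borel_of_topology T = sigma (topspace T) {U. openin T U}"

text \<open>
  The state space is \<open>topspace T\<close>, the sample space is \<open>space M\<close>, and nonnegative time is the
  subset \<open>{0..}\<close> of the reals; values of \<open>\<theta>\<close> and \<open>\<phi>\<close> outside these carriers are unconstrained.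
  Equations for \<open>\<theta>\<close> and \<open>\<phi>\<close> hold for every sample point, not just almost surely.
\<close>

locale random_dynamical_system = prob_space M
  for M :: "'w measure"
    and \<theta> :: "real \<Rightarrow> 'w \<Rightarrow> 'w"
    and T :: "'x topology"
    and \<phi> :: "real \<Rightarrow> 'x \<Rightarrow> 'w \<Rightarrow> 'x" +
  assumes base_zero: "\<omega> \<in> space M \<Longrightarrow> \<theta> 0 \<omega> = \<omega>"
    and base_add: "\<omega> \<in> space M \<Longrightarrow> \<theta> (s + t) \<omega> = \<theta> s (\<theta> t \<omega>)"
    and base_measurable: "(\<lambda>(t, \<omega>). \<theta> t \<omega>) \<in> borel \<Otimes>\<^sub>M M \<rightarrow>\<^sub>M M"
    and base_invariant: "B \<in> sets M \<Longrightarrow> prob (\<theta> t ` B) = prob B"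
    and cocycle_zero: "\<lbrakk>x \<in> topspace T; \<omega> \<in> space M\<rbrakk> \<Longrightarrow> \<phi> 0 x \<omega> = x"
    and cocycle_add: "\<lbrakk>0 \<le> s; 0 \<le> t; x \<in> topspace T; \<omega> \<in> space M\<rbrakk>
      \<Longrightarrow> \<phi> (s + t) x \<omega> = \<phi> s (\<phi> t x \<omega>) (\<theta> t \<omega>)"
    and cocycle_measurable: "(\<lambda>(t, x, \<omega>). \<phi> t x \<omega>)
      \<in> restrict_space borel {0..} \<Otimes>\<^sub>M (borel_of_topology T \<Otimes>\<^sub>M M) \<rightarrow>\<^sub>M borel_of_topology T"
    and cocycle_continuous: "\<lbrakk>0 \<le> t; \<omega> \<in> space M\<rbrakk> \<Longrightarrow> continuous_map T T (\<lambda>x. \<phi> t x \<omega>)"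

definition cocycle_image :: "(real \<Rightarrow> 'x \<Rightarrow> 'w \<Rightarrow> 'x) \<Rightarrow> real \<Rightarrow> 'x set \<Rightarrow> 'w \<Rightarrow> 'x set" where
  "cocycle_image \<phi> t B \<omega> = (\<lambda>x. \<phi> t x \<omega>) ` B"

text \<open>
  Values in \<^typ>\<open>ennreal\<close> give the conventions \<open>sup \<emptyset> = 0\<close> and \<open>inf \<emptyset> = \<infinity>\<close>.
\<close>

definition semi_dist :: "('x \<Rightarrow> 'x \<Rightarrow> real) \<Rightarrow> 'x set \<Rightarrow> 'x set \<Rightarrow> ennreal" where
  "semi_dist d C B = (SUP c\<in>C. INF b\<in>B. ennreal (d c b))"

definition set_section :: "('x \<times> 'w) set \<Rightarrow> 'w \<Rightarrow> 'x set" where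
  "set_section C \<omega> = {x. (x, \<omega>) \<in> C}"

definition random_set :: "'w measure \<Rightarrow> 'x topology \<Rightarrow> ('x \<times> 'w) set \<Rightarrow> bool" where
  "random_set M T C \<longleftrightarrow> C \<in> sets (borel_of_topology T \<Otimes>\<^sub>M M)"

definition compact_random_set :: "'w measure \<Rightarrow> 'x topology \<Rightarrow> ('x \<times> 'w) set \<Rightarrow> bool" where
  "compact_random_set M T C \<longleftrightarrow>
     random_set M T C \<and> (\<forall>\<omega>\<in>space M. compactin T (set_section C \<omega>))"

text \<open>The exceptional null set is common to all times \<open>t\<close>.\<close>

definition strictly_invariant ::
  "'w measure \<Rightarrow> (real \<Rightarrow> 'w \<Rightarrow> 'w) \<Rightarrow> (real \<Rightarrow> 'x \<Rightarrow> 'w \<Rightarrow> 'x) \<Rightarrow> ('x \<times> 'w) set \<Rightarrow> bool" where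
  "strictly_invariant M \<theta> \<phi> C \<longleftrightarrow>
     (AE \<omega> in M. \<forall>t\<ge>0. cocycle_image \<phi> t (set_section C \<omega>) \<omega> = set_section C (\<theta> t \<omega>))"

text \<open>In the two definitions below, \<open>d\<close> is meant to be a metric on \<open>topspace T\<close> inducing \<open>T\<close>.\<close>

definition global_random_pullback_attractor ::
  "'w measure \<Rightarrow> (real \<Rightarrow> 'w \<Rightarrow> 'w) \<Rightarrow> 'x topology \<Rightarrow> ('x \<Rightarrow> 'x \<Rightarrow> real) \<Rightarrow>
   (real \<Rightarrow> 'x \<Rightarrow> 'w \<Rightarrow> 'x) \<Rightarrow> ('x \<times> 'w) set \<Rightarrow> bool" where
  "global_random_pullback_attractor M \<theta> T d \<phi> C \<longleftrightarrow>
     compact_random_set M T C \<and> strictly_invariant M \<theta> \<phi> C \<and>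
     (AE \<omega> in M. ((\<lambda>t. semi_dist d (cocycle_image \<phi> t (topspace T) (\<theta> (- t) \<omega>))
                                   (set_section C \<omega>)) \<longlongrightarrow> 0) at_top)"

definition global_random_forward_attractor ::
  "'w measure \<Rightarrow> (real \<Rightarrow> 'w \<Rightarrow> 'w) \<Rightarrow> 'x topology \<Rightarrow> ('x \<Rightarrow> 'x \<Rightarrow> real) \<Rightarrow>
   (real \<Rightarrow> 'x \<Rightarrow> 'w \<Rightarrow> 'x) \<Rightarrow> ('x \<times> 'w) set \<Rightarrow> bool" where
  "global_random_forward_attractor M \<theta> T d \<phi> C \<longleftrightarrow>
     compact_random_set M T C \<and> strictly_invariant M \<theta> \<phi> C \<and>
     (AE \<omega> in M. ((\<lambda>t. semi_dist d (cocycle_image \<phi> t (topspace T) \<omega>)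
                                   (set_section C (\<theta> t \<omega>))) \<longlongrightarrow> 0) at_top)"

definition pullback_intersection ::
  "(real \<Rightarrow> 'w \<Rightarrow> 'w) \<Rightarrow> 'x set \<Rightarrow> (real \<Rightarrow> 'x \<Rightarrow> 'w \<Rightarrow> 'x) \<Rightarrow> 'w \<Rightarrow> 'x set" where
  "pullback_intersection \<theta> X \<phi> \<omega> = (\<Inter>t\<in>{0..}. cocycle_image \<phi> t X (\<theta> (- t) \<omega>))"

end

theory Submission
  imports Defs
begin

text \<open>
  By the cocycle property the sets \<open>\<phi>(t, X, \<theta>\<^sub>-\<^sub>t \<omega>)\<close> decrease in \<open>t\<close>; being nonempty subsets of a
  finite set, they are eventually constant, equal to \<open>A(\<omega>)\<close>. Invariance of \<open>A\<close> follows from this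
  for every \<open>\<omega>\<close>, so the events \<open>E\<^sub>n = {\<omega>. \<phi>(n, X, \<omega>) = A(\<theta>\<^sub>n \<omega>)}\<close> increase in \<open>n\<close>. Since \<open>E\<^sub>n\<close> is the
  image under \<open>\<theta>\<^sub>-\<^sub>n\<close> of \<open>{\<omega>. \<phi>(n, X, \<theta>\<^sub>-\<^sub>n \<omega>) = A(\<omega>)}\<close>, whose probability tends to 1, the union of
  the \<open>E\<^sub>n\<close> has full measure, which turns pullback into forward absorption.
\<close>

section \<open>Decreasing families of finite sets indexed by real time\<close>

lemma antimono_real_finite_set_stabilizes:
  fixes F :: "real \<Rightarrow> 'a set"
  assumes fin: "finite (F 0)" and anti: "\<And>s t. 0 \<le> s \<Longrightarrow> s \<le> t \<Longrightarrow> F t \<subseteq> F s"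
  shows "\<exists>T>0. \<forall>t\<ge>T. F t = (\<Inter>s\<in>{0..}. F s)"
proof -
  have finF: "finite (F t)" if "0 \<le> t" for t
    using finite_subset[OF anti[of 0 t] fin] that by simp
  \<comment> \<open>A time of least cardinality exists since cardinalities are natural numbers. A
    later set lies inside \<open>F t0\<close> and has at least as many elements, so it equals
    \<open>F t0\<close>.\<close>
  obtain t0 where t0: "0 \<le> t0" and min: "\<And>t. 0 \<le> t \<Longrightarrow> card (F t0) \<le> card (F t)"
    using arg_min_nat_lemma[of "\<lambda>t. 0 \<le> t" 0 "\<lambda>t. card (F t)"] by auto
  have const: "F t = F t0" if "t0 \<le> t" for t
    using card_subset_eq[OF finF[OF t0] anti[OF t0 that]] t0 that min[of t]
      card_mono[OF finF[OF t0] anti[OF t0 that]] by simp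
  have "F t0 \<subseteq> F s" if "0 \<le> s" for s
    using const[of "max s t0"] anti[of s "max s t0"] that by simp
  with t0 have "(\<Inter>s\<in>{0..}. F s) = F t0"
    by auto
  \<comment> \<open>The minimizing time may be 0; the shift by 1 makes the witness strictly
    positive.\<close>
  moreover have "F t = F t0" if "t0 + 1 \<le> t" for t
    using that by (intro const) simp
  ultimately have "t0 + 1 > 0 \<and> (\<forall>t\<ge>t0 + 1. F t = (\<Inter>s\<in>{0..}. F s))"
    using t0 by (metis add_nonneg_pos zero_less_one)
  then show ?thesis ..
qed

section \<open>Borel sets and semi-distance of a discrete space\<close>

lemma sets_borel_of_discrete_topology: "sets (borel_of_topology (discrete_topology X)) = Pow X"
  by (simp add: borel_of_topology_def Pow_def [symmetric] sigma_algebra.sigma_sets_eq sigma_algebra_Pow)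

lemma space_borel_of_discrete_topology [simp]:
  "space (borel_of_topology (discrete_topology X)) = X"
  by (simp add: borel_of_topology_def space_measure_of_conv)

lemma semi_dist_self:
  assumes "\<And>x. x \<in> B \<Longrightarrow> d x x = 0"
  shows "semi_dist d B B = 0"
proof -
  have "(INF b\<in>B. ennreal (d c b)) \<le> 0" if "c \<in> B" for c
    using INF_lower[OF that, of "\<lambda>b. ennreal (d c b)"] assms[OF that] by simp
  then have "semi_dist d B B \<le> 0"
    unfolding semi_dist_def by (rule SUP_least)
  then show ?thesis by simp
qed

text \<open>Reduces attraction to absorption: once the two sets coincide, their semi-distance is
  exactly 0, because the 0-1 metric \<open>discrete_metric.dd\<close> vanishes on the
  diagonal.\<close>

lemma tendsto_semi_dist_eventually_eq:
  fixes F G :: "real \<Rightarrow> 'a set"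
  assumes "\<exists>T>0. \<forall>t\<ge>T. F t = G t"
  shows "((\<lambda>t. semi_dist discrete_metric.dd (F t) (G t)) \<longlongrightarrow> 0) at_top"
proof (rule tendsto_eventually)
  have self: "semi_dist discrete_metric.dd B B = 0" for B :: "'a set"
    by (rule semi_dist_self) (simp add: discrete_metric.dd_def)
  obtain T where "\<And>t. t \<ge> T \<Longrightarrow> F t = G t"
    using assms by blast
  then show "\<forall>\<^sub>F t in at_top. semi_dist discrete_metric.dd (F t) (G t) = 0"
    by (intro eventually_at_top_linorderI[of T]) (simp add: self)
qed

section \<open>Images under the cocycle\<close>

lemma cocycle_image_mono: "B \<subseteq> C \<Longrightarrow> cocycle_image \<phi> t B \<omega> \<subseteq> cocycle_image \<phi> t C \<omega>"
  by (auto simp: cocycle_image_def)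

context random_dynamical_system
begin

lemma base_map_measurable [measurable]: "\<theta> t \<in> M \<rightarrow>\<^sub>M M"
  using measurable_compose[OF measurable_Pair1' base_measurable, of t] by simp

lemma base_in_space: "\<omega> \<in> space M \<Longrightarrow> \<theta> t \<omega> \<in> space M"
  using measurable_space[OF base_map_measurable] .

lemma base_cancel: "\<omega> \<in> space M \<Longrightarrow> \<theta> (- t) (\<theta> t \<omega>) = \<omega>"
  using base_add[of \<omega> "- t" t] base_zero by simp

lemma base_cancel': "\<omega> \<in> space M \<Longrightarrow> \<theta> t (\<theta> (- t) \<omega>) = \<omega>"
  using base_cancel[of \<omega> "- t"] by simp

lemma cocycle_in_space:
  assumes "0 \<le> t" "x \<in> topspace T" "\<omega> \<in> space M"
  shows "\<phi> t x \<omega> \<in> topspace T"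
  using cocycle_continuous[OF assms(1,3)] assms(2) by (auto simp: continuous_map_def)

lemma cocycle_image_subset:
  assumes "0 \<le> t" "B \<subseteq> topspace T" "\<omega> \<in> space M"
  shows "cocycle_image \<phi> t B \<omega> \<subseteq> topspace T"
  using assms cocycle_in_space by (auto simp: cocycle_image_def)

lemma cocycle_image_add:
  assumes "0 \<le> s" "0 \<le> t" "B \<subseteq> topspace T" "\<omega> \<in> space M"
  shows "cocycle_image \<phi> (s + t) B \<omega> = cocycle_image \<phi> s (cocycle_image \<phi> t B \<omega>) (\<theta> t \<omega>)"
proof -
  have "\<phi> (s + t) x \<omega> = \<phi> s (\<phi> t x \<omega>) (\<theta> t \<omega>)" if "x \<in> B" for x
    using assms that by (intro cocycle_add) auto
  then show ?thesis
    by (simp add: cocycle_image_def image_image cong: image_cong)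
qed

text \<open>A start at time \<open>- t\<close> is an earlier start than \<open>- s\<close>. Running
  from \<open>- t\<close> to \<open>- s\<close> leads into some subset of the state space, and the
  remaining run of length \<open>s\<close> is the same for both.\<close>

lemma pullback_image_antimono:
  assumes "0 \<le> s" "s \<le> t" "\<omega> \<in> space M"
  shows "cocycle_image \<phi> t (topspace T) (\<theta> (- t) \<omega>)
    \<subseteq> cocycle_image \<phi> s (topspace T) (\<theta> (- s) \<omega>)"
proof -
  have "\<theta> (t - s) (\<theta> (- t) \<omega>) = \<theta> (- s) \<omega>"
    using base_add[of \<omega> "t - s" "- t"] assms by simp
  then have "cocycle_image \<phi> t (topspace T) (\<theta> (- t) \<omega>)
    = cocycle_image \<phi> s (cocycle_image \<phi> (t - s) (topspace T) (\<theta> (- t) \<omega>)) (\<theta> (- s) \<omega>)"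
    using cocycle_image_add[of s "t - s" "topspace T" "\<theta> (- t) \<omega>"] assms base_in_space by simp
  also have "\<dots> \<subseteq> cocycle_image \<phi> s (topspace T) (\<theta> (- s) \<omega>)"
    using assms base_in_space by (intro cocycle_image_mono cocycle_image_subset) simp_all
  finally show ?thesis .
qed

end

section \<open>Pullback absorption and invariance on a finite state space\<close>

locale finite_random_dynamical_system =
  random_dynamical_system M \<theta> "discrete_topology X" \<phi>
  for M :: "'w measure" and \<theta> and X :: "'x set" and \<phi> +
  assumes finite_states: "finite X" and nonempty_states: "X \<noteq> {}"
begin

abbreviation pullback_image :: "real \<Rightarrow> 'w \<Rightarrow> 'x set" where
  "pullback_image t \<omega> \<equiv> cocycle_image \<phi> t X (\<theta> (- t) \<omega>)"

abbreviation attractor :: "'w \<Rightarrow> 'x set" where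
  "attractor \<equiv> pullback_intersection \<theta> X \<phi>"

text \<open>The restriction to \<open>X \<times> space M\<close> is essential: off
  \<open>space M\<close> the maps are unconstrained, and a measurable set must lie in the product
  space.\<close>

definition attractor_graph :: "('x \<times> 'w) set" where
  "attractor_graph = {(x, \<omega>) \<in> X \<times> space M. x \<in> attractor \<omega>}"

lemma pullback_absorption:
  assumes "\<omega> \<in> space M"
  shows "\<exists>T>0. \<forall>t\<ge>T. pullback_image t \<omega> = attractor \<omega>"
  unfolding pullback_intersection_def
  using pullback_image_antimono[OF _ _ assms] finite_states
  by (intro antimono_real_finite_set_stabilizes) (simp_all add: cocycle_image_def)

text \<open>By stabilization the intersection is itself one of the intersected sets, hence an image
  of the nonempty \<open>X\<close>.\<close>

lemma attractor_nonempty: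
  assumes "\<omega> \<in> space M"
  shows "attractor \<omega> \<noteq> {}"
  using pullback_absorption[OF assms] nonempty_states
  by (metis cocycle_image_def image_is_empty order_refl)

lemma attractor_subset:
  assumes "\<omega> \<in> space M"
  shows "attractor \<omega> \<subseteq> X"
proof -
  have "attractor \<omega> \<subseteq> pullback_image 0 \<omega>"
    unfolding pullback_intersection_def by (rule INF_lower) simp
  also have "\<dots> \<subseteq> X"
    using cocycle_image_subset[of 0 X] assms base_in_space by simp
  finally show ?thesis .
qed

lemma set_section_attractor_graph:
  "\<omega> \<in> space M \<Longrightarrow> set_section attractor_graph \<omega> = attractor \<omega>"
  using attractor_subset by (auto simp: set_section_def attractor_graph_def)

text \<open>Each side is a pullback image at a late time, and the cocycle property turns the one for
  \<omega> at time \<open>s\<close> into the one for \<open>\<theta> t \<omega>\<close> at time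
  \<open>t + s\<close>. This works for every \<omega>, with no exceptional set.\<close>

lemma attractor_invariant:
  assumes t: "0 \<le> t" and \<omega>: "\<omega> \<in> space M"
  shows "cocycle_image \<phi> t (attractor \<omega>) \<omega> = attractor (\<theta> t \<omega>)"
proof -
  obtain T1 where T1: "T1 > 0" "\<And>s. s \<ge> T1 \<Longrightarrow> pullback_image s \<omega> = attractor \<omega>"
    using pullback_absorption[OF \<omega>] by blast
  obtain T2 where T2: "\<And>s. s \<ge> T2 \<Longrightarrow> pullback_image s (\<theta> t \<omega>) = attractor (\<theta> t \<omega>)"
    using pullback_absorption[OF base_in_space[OF \<omega>]] by blast
  \<comment> \<open>Late enough for both: \<open>s\<close> reaches \<open>T1\<close>, which also
    makes it positive, and \<open>t + s\<close> reaches \<open>T2\<close> since \<open>t\<close> is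
    nonnegative.\<close>
  define s where "s = max T1 T2"
  have shift: "\<theta> (- (t + s)) (\<theta> t \<omega>) = \<theta> (- s) \<omega>"
    using base_add[of \<omega> "- (t + s)" t] \<omega> by simp
  have "cocycle_image \<phi> t (attractor \<omega>) \<omega> = cocycle_image \<phi> t (pullback_image s \<omega>) \<omega>"
    using T1 by (simp add: s_def)
  also have "\<dots> = cocycle_image \<phi> (t + s) X (\<theta> (- s) \<omega>)"
    using cocycle_image_add[of t s X "\<theta> (- s) \<omega>"] t T1(1) \<omega> base_in_space base_cancel'
    by (simp add: s_def)
  also have "\<dots> = attractor (\<theta> t \<omega>)"
    using T2[of "t + s"] t shift by (simp add: s_def)
  finally show ?thesis .
qed

section \<open>Measurability of the attractor\<close>

lemma pullback_image_event:
  assumes "0 \<le> t" "y \<in> X"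
  shows "{\<omega> \<in> space M. y \<in> pullback_image t \<omega>} \<in> sets M"
proof -
  have "(\<lambda>\<omega>. \<phi> t x (\<theta> (- t) \<omega>)) \<in> M \<rightarrow>\<^sub>M borel_of_topology (discrete_topology X)"
    if "x \<in> X" for x
  proof -
    have "(\<lambda>\<omega>. (t, x, \<theta> (- t) \<omega>)) \<in> M \<rightarrow>\<^sub>M
        restrict_space borel {0..} \<Otimes>\<^sub>M (borel_of_topology (discrete_topology X) \<Otimes>\<^sub>M M)"
      using assms that by (intro measurable_Pair measurable_const base_map_measurable) auto
    from measurable_compose[OF this cocycle_measurable] show ?thesis by simp
  qed
  then have "(\<lambda>\<omega>. \<phi> t x (\<theta> (- t) \<omega>)) -` {y} \<inter> space M \<in> sets M" if "x \<in> X" for x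
    using assms that by (intro measurable_sets) (auto simp: sets_borel_of_discrete_topology)
  \<comment> \<open>A state \<open>y\<close> is hit iff some starting point reaches it; finiteness
    of \<open>X\<close> keeps this union of events measurable.\<close>
  then have "(\<Union>x\<in>X. (\<lambda>\<omega>. \<phi> t x (\<theta> (- t) \<omega>)) -` {y} \<inter> space M) \<in> sets M"
    using finite_states by blast
  also have "(\<Union>x\<in>X. (\<lambda>\<omega>. \<phi> t x (\<theta> (- t) \<omega>)) -` {y} \<inter> space M)
      = {\<omega> \<in> space M. y \<in> pullback_image t \<omega>}"
    by (auto simp: cocycle_image_def)
  finally show ?thesis .
qed

text \<open>Replaces an uncountable intersection by a countable one, as measurability requires. A
  single integer time beyond the absorption time already gives the attractor.\<close>

lemma attractor_eq_countable_INT: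
  assumes "\<omega> \<in> space M"
  shows "attractor \<omega> = (\<Inter>n. pullback_image (real n) \<omega>)"
proof
  show "attractor \<omega> \<subseteq> (\<Inter>n. pullback_image (real n) \<omega>)"
    by (auto simp: pullback_intersection_def)
  obtain T where T: "\<And>t. t \<ge> T \<Longrightarrow> pullback_image t \<omega> = attractor \<omega>"
    using pullback_absorption[OF assms] by blast
  obtain n where "T \<le> real n"
    using real_arch_simple by blast
  then show "(\<Inter>n. pullback_image (real n) \<omega>) \<subseteq> attractor \<omega>"
    using T[of "real n"] by blast
qed

lemma attractor_event:
  assumes "y \<in> X"
  shows "{\<omega> \<in> space M. y \<in> attractor \<omega>} \<in> sets M"
proof -
  have "{\<omega> \<in> space M. y \<in> attractor \<omega>}
      = (\<Inter>n. {\<omega> \<in> space M. y \<in> pullback_image (real n) \<omega>})"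
    by (auto simp: attractor_eq_countable_INT)
  also have "\<dots> \<in> sets M"
    using pullback_image_event[OF _ assms] by (intro sets.countable_INT) auto
  finally show ?thesis .
qed

lemma compact_random_set_attractor_graph:
  "compact_random_set M (discrete_topology X) attractor_graph"
proof -
  \<comment> \<open>Slicing by states exhibits the graph as a finite union of measurable
    rectangles.\<close>
  have "attractor_graph = (\<Union>y\<in>X. {y} \<times> {\<omega> \<in> space M. y \<in> attractor \<omega>})"
    by (auto simp: attractor_graph_def)
  also have "\<dots> \<in> sets (borel_of_topology (discrete_topology X) \<Otimes>\<^sub>M M)"
    using attractor_event
    by (intro sets.finite_UN finite_states pair_measureI)
      (auto simp: sets_borel_of_discrete_topology)
  finally have "random_set M (discrete_topology X) attractor_graph"
    by (simp add: random_set_def)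
  then show ?thesis
    using set_section_attractor_graph attractor_subset finite_subset[OF attractor_subset finite_states]
    by (simp add: compact_random_set_def compactin_discrete_topology)
qed

lemma strictly_invariant_attractor_graph: "strictly_invariant M \<theta> \<phi> attractor_graph"
  unfolding strictly_invariant_def
  by (intro AE_I2) (simp add: set_section_attractor_graph base_in_space attractor_invariant)

section \<open>From pullback to forward absorption\<close>

lemma forward_absorption:
  "AE \<omega> in M. \<exists>T>0. \<forall>t\<ge>T. cocycle_image \<phi> t X \<omega> = attractor (\<theta> t \<omega>)"
proof -
  define D where "D n = {\<omega> \<in> space M. pullback_image (real n) \<omega> = attractor \<omega>}" for n
  define E where "E n = {\<omega> \<in> space M. cocycle_image \<phi> (real n) X \<omega> = attractor (\<theta> (real n) \<omega>)}" for n
  have D_sets: "D n \<in> sets M" for n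
  proof -
    have "pullback_image (real n) \<omega> \<subseteq> X" "attractor \<omega> \<subseteq> X" if "\<omega> \<in> space M" for \<omega>
      using cocycle_image_subset[of "real n" X] attractor_subset base_in_space that by simp_all
    \<comment> \<open>Both sets lie in \<open>X\<close>, so their equality is a finite conjunction
      of measurable conditions on single states.\<close>
    then have "D n = {\<omega> \<in> space M. \<forall>y\<in>X. y \<in> pullback_image (real n) \<omega> \<longleftrightarrow> y \<in> attractor \<omega>}"
      unfolding D_def by (intro Collect_cong conj_cong refl) blast
    also have "\<dots> \<in> sets M"
      using pullback_image_event[of "real n"] attractor_event finite_states
      by (intro sets.sets_Collect_finite_All sets.sets_Collect) auto
    finally show ?thesis .
  qed
  have E_vimage: "E n = \<theta> (real n) -` D n \<inter> space M" for n
  proof -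
    have "\<theta> (real n) \<omega> \<in> D n \<longleftrightarrow> cocycle_image \<phi> (real n) X \<omega> = attractor (\<theta> (real n) \<omega>)"
      if "\<omega> \<in> space M" for \<omega>
      using base_in_space[OF that, of "real n"] by (simp add: D_def base_cancel[OF that])
    then show ?thesis
      by (auto simp: E_def)
  qed
  have E_sets: "E n \<in> sets M" for n
    unfolding E_vimage using base_map_measurable D_sets by (rule measurable_sets)
  \<comment> \<open>The preimage form gives measurability; this image form is the one to which
    \<open>base_invariant\<close> applies.\<close>
  have E_image: "E n = \<theta> (- real n) ` D n" for n
  proof
    show "E n \<subseteq> \<theta> (- real n) ` D n"
    proof
      fix \<omega> assume "\<omega> \<in> E n"
      then have "\<theta> (real n) \<omega> \<in> D n" "\<theta> (- real n) (\<theta> (real n) \<omega>) = \<omega>"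
        by (simp_all add: E_vimage base_cancel)
      then show "\<omega> \<in> \<theta> (- real n) ` D n" by (metis image_eqI)
    qed
    show "\<theta> (- real n) ` D n \<subseteq> E n"
      by (auto simp: E_vimage D_def base_cancel' base_in_space)
  qed
  \<comment> \<open>Absorption at the integer time \<open>n\<close> persists at all later real
    times: after time \<open>n\<close> only the attractor is transported, and it is
    invariant.\<close>
  have absorbed: "cocycle_image \<phi> t X \<omega> = attractor (\<theta> t \<omega>)"
    if "\<omega> \<in> E n" "real n \<le> t" for \<omega> n t
  proof -
    from that have \<omega>: "\<omega> \<in> space M"
      and eq: "cocycle_image \<phi> (real n) X \<omega> = attractor (\<theta> (real n) \<omega>)"
      by (simp_all add: E_def)
    have "cocycle_image \<phi> t X \<omega>
        = cocycle_image \<phi> (t - real n) (attractor (\<theta> (real n) \<omega>)) (\<theta> (real n) \<omega>)"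
      using cocycle_image_add[of "t - real n" "real n" X \<omega>] that \<omega> eq by simp
    also have "\<dots> = attractor (\<theta> (t - real n) (\<theta> (real n) \<omega>))"
      using that \<omega> by (intro attractor_invariant base_in_space) simp_all
    also have "\<dots> = attractor (\<theta> t \<omega>)"
      using base_add[OF \<omega>, of "t - real n" "real n"] by simp
    finally show ?thesis .
  qed
  have "incseq E"
  proof (rule monoI, rule subsetI)
    fix m n \<omega> assume "m \<le> n" "\<omega> \<in> E m"
    then show "\<omega> \<in> E n"
      using absorbed[of \<omega> m "real n"] by (simp add: E_def)
  qed
  \<comment> \<open>Later pullback images are squeezed between the attractor and the image at time
    \<open>m\<close>, which already equals it.\<close>
  have "incseq D"
  proof (rule monoI, rule subsetI)
    fix m n \<omega> assume "m \<le> n" "\<omega> \<in> D m"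
    then have "\<omega> \<in> space M" "pullback_image (real n) \<omega> \<subseteq> attractor \<omega>"
      using pullback_image_antimono[of "real m" "real n" \<omega>] by (auto simp: D_def)
    moreover have "attractor \<omega> \<subseteq> pullback_image (real n) \<omega>"
      unfolding pullback_intersection_def by (rule INF_lower) simp
    ultimately show "\<omega> \<in> D n" by (auto simp: D_def)
  qed
  have "(\<Union>n. D n) = space M"
  proof
    show "space M \<subseteq> (\<Union>n. D n)"
    proof
      fix \<omega> assume \<omega>: "\<omega> \<in> space M"
      then obtain T where "\<And>t. t \<ge> T \<Longrightarrow> pullback_image t \<omega> = attractor \<omega>"
        using pullback_absorption by blast
      moreover obtain n where "T \<le> real n"
        using real_arch_simple by blast
      ultimately show "\<omega> \<in> (\<Union>n. D n)"
        using \<omega> by (auto simp: D_def)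
    qed
  qed (auto simp: D_def)
  \<comment> \<open>Continuity from below for both sequences: their probabilities agree for each
    \<open>n\<close>, so the limits agree, and the union of the \<open>E n\<close> has probability
    1.\<close>
  then have "(\<lambda>n. prob (D n)) \<longlonglongrightarrow> 1"
    using finite_Lim_measure_incseq[OF _ \<open>incseq D\<close>] D_sets prob_space by auto
  moreover have "prob (E n) = prob (D n)" for n
    unfolding E_image using base_invariant[OF D_sets] .
  moreover have "(\<lambda>n. prob (E n)) \<longlonglongrightarrow> prob (\<Union>n. E n)"
    using finite_Lim_measure_incseq[OF _ \<open>incseq E\<close>] E_sets by auto
  ultimately have "prob (\<Union>n. E n) = 1"
    using LIMSEQ_unique by auto
  then have "AE \<omega> in M. \<omega> \<in> (\<Union>n. E n)"
    using prob_eq_1[of "\<Union>n. E n"] E_sets by auto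
  then show ?thesis
  proof (rule eventually_mono)
    fix \<omega> assume "\<omega> \<in> (\<Union>n. E n)"
    then obtain n where "\<omega> \<in> E n" by blast
    then show "\<exists>T>0. \<forall>t\<ge>T. cocycle_image \<phi> t X \<omega> = attractor (\<theta> t \<omega>)"
      \<comment> \<open>The added 1 keeps the time positive when \<open>n\<close> is 0.\<close>
      using absorbed by (intro exI[of _ "real n + 1"]) auto
  qed
qed

section \<open>Global pullback and forward attraction\<close>

lemma global_random_pullback_attractor_attractor_graph:
  "global_random_pullback_attractor M \<theta> (discrete_topology X) discrete_metric.dd \<phi> attractor_graph"
  unfolding global_random_pullback_attractor_def
  by (intro conjI compact_random_set_attractor_graph strictly_invariant_attractor_graph AE_I2
      tendsto_semi_dist_eventually_eq)
    (simp add: set_section_attractor_graph pullback_absorption)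

lemma global_random_forward_attractor_attractor_graph:
  "global_random_forward_attractor M \<theta> (discrete_topology X) discrete_metric.dd \<phi> attractor_graph"
proof -
  have "AE \<omega> in M. ((\<lambda>t. semi_dist discrete_metric.dd
      (cocycle_image \<phi> t (topspace (discrete_topology X)) \<omega>)
      (set_section attractor_graph (\<theta> t \<omega>))) \<longlongrightarrow> 0) at_top"
    using forward_absorption
  \<comment> \<open>This form retains \<open>\<omega> \<in> space M\<close>, which is needed to
    identify the section at \<open>\<theta> t \<omega>\<close> with the attractor.\<close>
  proof (rule AE_mp, intro AE_I2 impI)
    fix \<omega> assume "\<omega> \<in> space M" "\<exists>T>0. \<forall>t\<ge>T. cocycle_image \<phi> t X \<omega> = attractor (\<theta> t \<omega>)"
    then show "((\<lambda>t. semi_dist discrete_metric.dd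
        (cocycle_image \<phi> t (topspace (discrete_topology X)) \<omega>)
        (set_section attractor_graph (\<theta> t \<omega>))) \<longlongrightarrow> 0) at_top"
      by (intro tendsto_semi_dist_eventually_eq) (simp add: set_section_attractor_graph base_in_space)
  qed
  then show ?thesis
    unfolding global_random_forward_attractor_def
    by (intro conjI compact_random_set_attractor_graph strictly_invariant_attractor_graph)
qed

end

theorem theorem6:
  fixes M :: "'w measure"
    and \<theta> :: "real \<Rightarrow> 'w \<Rightarrow> 'w"
    and X :: "'x set"
    and \<phi> :: "real \<Rightarrow> 'x \<Rightarrow> 'w \<Rightarrow> 'x"
  assumes "finite X" and "X \<noteq> {}"
    and "random_dynamical_system M \<theta> (discrete_topology X) \<phi>"
  shows "(\<forall>\<omega>\<in>space M. pullback_intersection \<theta> X \<phi> \<omega> \<noteq> {})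
       \<and> global_random_pullback_attractor M \<theta> (discrete_topology X) discrete_metric.dd \<phi>
           {(x, \<omega>) \<in> X \<times> space M. x \<in> pullback_intersection \<theta> X \<phi> \<omega>}
       \<and> global_random_forward_attractor M \<theta> (discrete_topology X) discrete_metric.dd \<phi>
           {(x, \<omega>) \<in> X \<times> space M. x \<in> pullback_intersection \<theta> X \<phi> \<omega>}
       \<and> (\<forall>\<omega>\<in>space M. \<exists>T>0. \<forall>t\<ge>T.
            cocycle_image \<phi> t X (\<theta> (- t) \<omega>) = pullback_intersection \<theta> X \<phi> \<omega>)
       \<and> (AE \<omega> in M. \<exists>T>0. \<forall>t\<ge>T.
            cocycle_image \<phi> t X \<omega> = pullback_intersection \<theta> X \<phi> (\<theta> t \<omega>))"
proof -
  interpret finite_random_dynamical_system M \<theta> X \<phi>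
    using assms by (intro finite_random_dynamical_system.intro
        finite_random_dynamical_system_axioms.intro)
  show ?thesis
    using attractor_nonempty
      global_random_pullback_attractor_attractor_graph[unfolded attractor_graph_def]
      global_random_forward_attractor_attractor_graph[unfolded attractor_graph_def]
      pullback_absorption forward_absorption
    by (intro conjI ballI)
qed

end
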